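(* Let $n\geq 1$, let $U\subseteq\mathcal{M}_n$ be a domain (nonempty connected open set) containing the null matrix, and let $F:U\rightarrow\mathcal{M}_n$ be a function of class $\mathcal{C}^1$ (in the real sense) with $F(0)=0$ such that $$\sigma(F(x)-F(y))\cap\sigma(x-y)\neq\varnothing\qquad (x,y\in U).$$ Then there exists an invertible $u\in\mathcal{M}_n$ such that either $F(x)=uxu^{-1}$ for all $x\in U$, or $F(x)=ux^{t}u^{-1}$ for all $x\in U$.
   Context: $\mathcal{M}_n$ denotes the space of all complex $n\times n$ matrices (identified with $\mathbb{R}^{2n^2}$ for real differentiability). For $x\in\mathcal{M}_n$, $\sigma(x)$ denotes the spectrum (set of eigenvalues) of $x$, and $x^t$ denotes its transpose. *)

theory Defs
  imports "HOL-Analysis.Analysis"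
begin

text \<open>n x n complex matrices, n = CARD('n) (arbitrary, >= 1 automatically).\<close>
type_synonym 'n cmat = "complex ^ 'n ^ 'n"

definition mat_spectrum :: "complex ^ 'n ^ 'n \<Rightarrow> complex set" where
  "mat_spectrum A = {c. \<exists>v :: complex ^ 'n. v \<noteq> 0 \<and> A *v v = c *s v}"

definition C1_on :: "'a::real_normed_vector set \<Rightarrow> ('a \<Rightarrow> 'b::real_normed_vector) \<Rightarrow> bool" where
  "C1_on U f \<longleftrightarrow> (\<exists>f' :: 'a \<Rightarrow> 'a \<Rightarrow>\<^sub>L 'b.
      (\<forall>x\<in>U. (f has_derivative blinfun_apply (f' x)) (at x)) \<and> continuous_on U f')"

end

theory Submission
  imports Defs "HOL-Complex_Analysis.Cauchy_Integral_Formula"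
    "HOL-Computational_Algebra.Fundamental_Theorem_Algebra"
begin

text \<open>
  Each derivative \<open>T\<close> of \<open>F\<close> is a real-linear map for which \<open>T h\<close> and \<open>h\<close> always have a common
  eigenvalue. If \<open>D\<close> is diagonal with distinct entries and \<open>J\<close> is the all-ones matrix, then for
  every real \<open>s \<noteq> 0\<close> the eigenvalues \<open>z\<close> of \<open>D + s J\<close> satisfy \<open>1 = s (\<Sum>i. 1 / (z - D\<^sub>i))\<close>, so \<open>s\<close>
  is a rational function of \<open>z\<close>. Substituting it into \<open>det (z - T D - s T J)\<close> and clearing
  denominators gives a polynomial in \<open>z\<close> with infinitely many roots; it vanishes, and its values at
  the \<open>D\<^sub>i\<close> show that every eigenvalue of \<open>D\<close> is an eigenvalue of \<open>T D\<close>. Conjugation extends this to all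
  matrices with simple spectrum, and perturbing a diagonal matrix in the direction \<open>h\<close> yields
  \<open>tr (T h)\<^sup>k = tr h\<^sup>k\<close> for \<open>k \<le> 3\<close>. The case \<open>k = 2\<close> makes \<open>T\<close> a complex-linear bijective isometry of
  the trace form, the case \<open>k = 3\<close> a Jordan homomorphism, hence by Herstein an automorphism or an
  antiautomorphism of the matrix algebra, which is inner up to transposition.

  Since its derivatives are complex-linear, \<open>F\<close> is holomorphic, so it has symmetric second
  derivatives. As all first derivatives are isometries of the same nondegenerate symmetric form, the
  trilinear form \<open>tr (F''(x)(a, b) \<cdot> F'(x) c)\<close> is symmetric in \<open>a, b\<close> and skew in \<open>a, c\<close>,
  and therefore zero. Thus \<open>F'\<close> is constant and \<open>F\<close> is linear.
\<close>

section \<open>Spectra and characteristic polynomials\<close>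

lemma matrix_add_rdistrib: "(A + B) ** C = A ** C + B ** C"
  by (vector matrix_matrix_mult_def sum.distrib[symmetric] field_simps)

lemma mat_mult_vec: "mat c *v v = c *s (v :: 'a::comm_semiring_1 ^ 'n)"
  by (simp add: vec_eq_iff matrix_vector_mult_def mat_def if_distrib[of "\<lambda>t. t * _"] cong: if_cong)

lemma mat_spectrum_iff_det: "z \<in> mat_spectrum A \<longleftrightarrow> det (mat z - A) = 0"
proof -
  have "det (mat z - A) = 0 \<longleftrightarrow> (\<exists>v. v \<noteq> 0 \<and> (mat z - A) *v v = 0)"
    by (metis invertible_det_nz invertible_left_inverse matrix_left_invertible_ker)
  also have "\<dots> \<longleftrightarrow> z \<in> mat_spectrum A"
    by (auto simp: mat_spectrum_def matrix_vector_mult_diff_rdistrib mat_mult_vec)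
  finally show ?thesis by simp
qed

lemma poly_det: "poly (det M) z = det (\<chi> i j. poly (M $ i $ j) z)"
  for M :: "'a::comm_ring_1 poly ^ 'n ^ 'n"
  by (simp add: det_def poly_sum poly_prod poly_mult)

lemma mat_spectrum_similarity:
  fixes P Q A :: "complex ^ 'n ^ 'n"
  assumes "Q ** P = mat 1"
  shows "mat_spectrum (P ** A ** Q) = mat_spectrum A"
proof -
  have "P ** Q = mat 1" using assms matrix_left_right_inverse by blast
  then have "mat z - P ** A ** Q = P ** (mat z - A) ** Q" for z
    by (simp add: matrix_eq matrix_vector_mul_assoc[symmetric] matrix_vector_mult_diff_rdistrib
        matrix_vector_mult_diff_distrib mat_mult_vec vector_scalar_commute[symmetric])
  moreover have "det P * det Q = 1"
    by (metis \<open>P ** Q = mat 1\<close> det_I det_mul)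
  ultimately show ?thesis
    by (auto simp: mat_spectrum_iff_det det_mul)
qed

lemma mat_spectrum_scale:
  assumes "z \<in> mat_spectrum (r *\<^sub>R A)" "r \<noteq> 0"
  shows "z / of_real r \<in> mat_spectrum A"
proof -
  obtain v where v: "v \<noteq> 0" "(r *\<^sub>R A) *v v = z *s v"
    using assms by (auto simp: mat_spectrum_def)
  have "of_real r * (A *v v) $ i = z * v $ i" for i
    using arg_cong[OF v(2), of "\<lambda>w. w $ i"]
    by (simp add: matrix_vector_mult_def sum_distrib_left) (simp add: scaleR_conv_of_real mult.assoc)
  then have "A *v v = (z / of_real r) *s v"
    using \<open>r \<noteq> 0\<close> by (simp add: vec_eq_iff field_simps)
  then show ?thesis using v(1) by (auto simp: mat_spectrum_def)
qed

definition charpoly :: "complex ^ 'n ^ 'n \<Rightarrow> complex poly" where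
  "charpoly A = det (\<chi> i j. (if i = j then [:- A $ i $ j, 1:] else [:- A $ i $ j:]))"

lemma poly_charpoly: "poly (charpoly A) z = det (mat z - A)"
  unfolding charpoly_def poly_det by (intro arg_cong[of _ _ det]) (simp add: vec_eq_iff mat_def)

lemma coeff_prod_linear:
  fixes f :: "'i \<Rightarrow> 'a::comm_ring_1 poly"
  assumes "finite S" "\<And>i. i \<in> S \<Longrightarrow> degree (f i) \<le> 1"
  shows "degree (prod f S) \<le> card S \<and> coeff (prod f S) (card S) = (\<Prod>i\<in>S. coeff (f i) 1)"
  using assms
proof (induction S rule: finite_induct)
  case (insert a S)
  then have IH: "degree (prod f S) \<le> card S" "coeff (prod f S) (card S) = (\<Prod>i\<in>S. coeff (f i) 1)"
    and a: "degree (f a) \<le> 1" by auto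
  have "degree (f a * prod f S) \<le> Suc (card S)"
    using degree_mult_le[of "f a" "prod f S"] IH a by linarith
  moreover have "coeff (f a * prod f S) (Suc (card S)) = coeff (f a) 1 * coeff (prod f S) (card S)"
  proof -
    have "coeff (f a * prod f S) (Suc (card S))
        = (\<Sum>i\<in>{0..Suc (card S)}. coeff (f a) i * coeff (prod f S) (Suc (card S) - i))"
      by (simp add: coeff_mult atMost_atLeast0)
    \<comment> \<open>For \<open>i = 0\<close> the other coefficient lies above the degree of
      \<open>prod f S\<close>; for \<open>i > 1\<close> that of \<open>f a\<close> vanishes.\<close>
    also have "\<dots> = (\<Sum>i\<in>{1}. coeff (f a) i * coeff (prod f S) (Suc (card S) - i))"
    proof (rule sum.mono_neutral_right)
      show "\<forall>i\<in>{0..Suc (card S)} - {1}. coeff (f a) i * coeff (prod f S) (Suc (card S) - i) = 0"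
      proof
        fix i assume "i \<in> {0..Suc (card S)} - {1}"
        then consider "i = 0" | "i > 1" by fastforce
        then show "coeff (f a) i * coeff (prod f S) (Suc (card S) - i) = 0"
          using IH(1) a by cases (auto simp: coeff_eq_0)
      qed
    qed auto
    finally show ?thesis by simp
  qed
  ultimately show ?case using insert IH by simp
qed simp

text \<open>Each product in the Leibniz expansion has factors of degree at most 1, so its
  coefficient at \<open>CARD('n)\<close> is the product of their linear coefficients; the signed sum
  of these is the determinant of the identity matrix.\<close>

lemma charpoly_monic:
  fixes A :: "complex ^ 'n ^ 'n"
  shows "degree (charpoly A) = CARD('n)" "lead_coeff (charpoly A) = 1"
proof -
  define M where "M = (\<chi> i j. (if i = j then [:- A $ i $ j, 1:] else [:- A $ i $ j:]))"
  have *: "degree (\<Prod>i\<in>UNIV. M $ i $ p i) \<le> CARD('n)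
      \<and> coeff (\<Prod>i\<in>UNIV. M $ i $ p i) CARD('n) = (\<Prod>i\<in>UNIV. coeff (M $ i $ p i) 1)" for p
    by (rule coeff_prod_linear) (auto simp: M_def)
  have s: "of_int (sign p) = [:of_int (sign p) :: complex:]" for p :: "'n \<Rightarrow> 'n"
    by (simp add: of_int_poly)
  have le: "degree (charpoly A) \<le> CARD('n)"
    unfolding charpoly_def M_def[symmetric] det_def s
    by (intro degree_sum_le) (use * in \<open>auto intro: order_trans[OF degree_smult_le]\<close>)
  have "coeff (charpoly A) CARD('n) = det (\<chi> i j. coeff (M $ i $ j) 1)"
    unfolding charpoly_def M_def[symmetric] det_def s coeff_sum
    by (intro sum.cong refl) (simp add: *)
  also have "(\<chi> i j. coeff (M $ i $ j) 1) = mat 1"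
    by (simp add: vec_eq_iff M_def mat_def)
  finally have "coeff (charpoly A) CARD('n) = 1" by simp
  with le show "degree (charpoly A) = CARD('n)" "lead_coeff (charpoly A) = 1"
    by (metis le_antisym le_degree zero_neq_one)+
qed

lemma finite_mat_spectrum: "finite (mat_spectrum A)"
proof -
  have "charpoly A \<noteq> 0" using charpoly_monic(2)[of A] by auto
  then have "finite {z. poly (charpoly A) z = 0}" by (rule poly_roots_finite)
  then show ?thesis by (simp add: mat_spectrum_iff_det poly_charpoly set_eq_iff cong: rev_conj_cong)
     (simp add: mat_spectrum_iff_det[symmetric])
qed

text \<open>If all roots had distance at least \<open>d\<close> from \<open>w\<close>, the
  factorization into linear factors would give \<open>p\<close> modulus at least
  \<open>d ^ degree p\<close> at \<open>w\<close>. This serves as continuity of eigenvalues under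
  perturbation.\<close>

lemma root_near:
  fixes p :: "complex poly"
  assumes "lead_coeff p = 1" "cmod (poly p w) < d ^ degree p" "d > 0"
  shows "\<exists>z. poly p z = 0 \<and> cmod (z - w) < d"
proof (rule ccontr)
  assume no: "\<not> ?thesis"
  have "p \<noteq> 0" using assms by auto
  then obtain A where A: "size A = degree p" "p = smult (lead_coeff p) (\<Prod>x\<in>#A. [:-x, 1:])"
    using alg_closed_imp_factorization by blast
  have p: "poly p z = (\<Prod>x\<in>#A. z - x)" for z
    by (subst A(2)) (simp add: assms(1) poly_prod_mset multiset.map_comp o_def)
  have "\<forall>x. x \<in># A \<longrightarrow> d \<le> cmod (w - x)"
  proof (intro allI impI)
    fix x assume "x \<in># A"
    then have "poly p x = 0" by (auto simp: p)
    with no show "d \<le> cmod (w - x)" by (metis norm_minus_commute not_le)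
  qed
  then have "d ^ size A \<le> cmod (\<Prod>x\<in>#A. w - x)"
    by (induction A) (use \<open>d > 0\<close> in \<open>auto simp: norm_mult intro!: mult_mono\<close>)
  then show False using assms(2) A(1) p[of w] by simp
qed

lemma tendsto_det:
  fixes f :: "'a \<Rightarrow> complex ^ 'n ^ 'n"
  assumes "(f \<longlongrightarrow> l) G"
  shows "((\<lambda>x. det (f x)) \<longlongrightarrow> det l) G"
  unfolding det_def by (intro tendsto_intros assms)

section \<open>Simple spectra\<close>

definition diag_mat :: "('n \<Rightarrow> complex) \<Rightarrow> complex ^ 'n ^ 'n" where
  "diag_mat l = (\<chi> i j. if i = j then l i else 0)"

lemma diag_mat_mult_vec: "(diag_mat l *v v) $ i = l i * v $ i"
  by (simp add: diag_mat_def matrix_vector_mult_def if_distrib[of "\<lambda>t. t * _"] cong: if_cong)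

text \<open>With \<open>t\<close> the sum of the entries of an eigenvector \<open>v\<close>, the
  eigenvalue equation reads \<open>s * t = (z - l i) * v $ i\<close>. If \<open>z = l i\<close>,
  then \<open>t = 0\<close>, all other entries vanish, and so does \<open>v\<close>. Otherwise solve
  for the entries and sum them.\<close>

lemma mat_spectrum_diag_plus_ones:
  fixes l :: "'n::finite \<Rightarrow> complex"
  assumes l: "inj l" and "s \<noteq> 0"
    and z: "z \<in> mat_spectrum (diag_mat l + s *\<^sub>R (\<chi> i j. 1))"
  shows "z \<noteq> l i" "of_real s * (\<Sum>i\<in>UNIV. 1 / (z - l i)) = 1"
proof -
  obtain v where v: "v \<noteq> 0" "(diag_mat l + s *\<^sub>R (\<chi> i j. 1)) *v v = z *s v"
    using z by (auto simp: mat_spectrum_def)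
  define t where "t = (\<Sum>j\<in>UNIV. v $ j)"
  have eq: "of_real s * t = (z - l i) * v $ i" for i
  proof -
    have "l i * v $ i + of_real s * t = z * v $ i"
      using arg_cong[OF v(2), of "\<lambda>w. w $ i"]
      by (simp add: matrix_vector_mult_add_rdistrib diag_mat_mult_vec)
         (simp add: matrix_vector_mult_def t_def scaleR_conv_of_real[where 'a=complex] sum_distrib_left)
    then show ?thesis by (simp add: algebra_simps)
  qed
  have ne: "z \<noteq> l i" for i
  proof
    assume zi: "z = l i"
    then have t0: "t = 0" using eq[of i] \<open>s \<noteq> 0\<close> by simp
    have "v $ j = 0" if "j \<noteq> i" for j
      using eq[of j] t0 zi injD[OF l, of i j] that by auto
    then have "t = v $ i" unfolding t_def by (simp add: sum.remove[of UNIV i])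
    then have "v = 0" using t0 \<open>\<And>j. j \<noteq> i \<Longrightarrow> v $ j = 0\<close> by (metis vec_eq_iff zero_index)
    with v show False by simp
  qed
  then show "z \<noteq> l i" .
  have vi: "v $ i = of_real s * t / (z - l i)" for i
    using eq[of i] ne[of i] by (simp add: field_simps)
  have "t \<noteq> 0" using vi v(1) by (auto simp: vec_eq_iff)
  have "t = of_real s * t * (\<Sum>i\<in>UNIV. 1 / (z - l i))"
    by (subst t_def) (simp add: vi sum_distrib_left)
  with \<open>t \<noteq> 0\<close> show "of_real s * (\<Sum>i\<in>UNIV. 1 / (z - l i)) = 1" by simp
qed

lemma det_scale: "det (\<chi> i j. c * A $ i $ j) = c ^ CARD('n) * det A"
  for A :: "'a::comm_ring_1 ^ 'n ^ 'n"
  using det_rows_mul[of "\<lambda>_. c" "\<lambda>i. A $ i"] by (simp add: vector_scalar_mult_def)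

text \<open>\<open>r / psi\<close> is the sum of the \<open>1 / (z - l i)\<close>, and \<open>\<zeta> s\<close> a common eigenvalue for the parameter \<open>s\<close>.\<close>

lemma diag_spectrum_transfer:
  fixes T :: "complex ^ 'n ^ 'n \<Rightarrow> complex ^ 'n ^ 'n" and l :: "'n \<Rightarrow> complex"
  assumes T: "linear T" and ov: "\<And>h. mat_spectrum (T h) \<inter> mat_spectrum h \<noteq> {}"
    and l: "inj l"
  shows "l k \<in> mat_spectrum (T (diag_mat l))"
proof -
  define J :: "complex ^ 'n ^ 'n" where "J = (\<chi> i j. 1)"
  define psi where "psi = (\<Prod>i\<in>UNIV. [:- l i, 1:])"
  define r where "r = (\<Sum>i\<in>UNIV. \<Prod>j\<in>UNIV - {i}. [:- l j, 1:])"
  \<comment> \<open>This is \<open>r\<close> times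
    \<open>mat z - T (diag_mat l) - s *\<^sub>R T J\<close> with \<open>psi / r\<close> substituted
    for \<open>s\<close>, so all entries are polynomials in \<open>z\<close>.\<close>
  define M where "M = (\<chi> i j. r * (if i = j then [:- T (diag_mat l) $ i $ j, 1:] else [:- T (diag_mat l) $ i $ j:])
    - psi * [:T J $ i $ j:])"
  have M: "(\<chi> i j. poly (M $ i $ j) z) =
     (\<chi> i j. poly r z * (mat z - T (diag_mat l)) $ i $ j - poly psi z * T J $ i $ j)" for z
    by (simp add: vec_eq_iff M_def mat_def algebra_simps)
  have ex: "\<exists>z. (\<forall>i. z \<noteq> l i) \<and> of_real s * (\<Sum>i\<in>UNIV. 1 / (z - l i)) = 1
      \<and> z \<in> mat_spectrum (T (diag_mat l) + s *\<^sub>R T J)" if "s \<noteq> 0" for s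
  proof -
    obtain z where "z \<in> mat_spectrum (T (diag_mat l + s *\<^sub>R J))" "z \<in> mat_spectrum (diag_mat l + s *\<^sub>R J)"
      using ov by blast
    with mat_spectrum_diag_plus_ones[OF l that, of z] show ?thesis
      by (auto simp: J_def linear_add[OF T] linear_scale[OF T])
  qed
  then obtain \<zeta> where \<zeta>: "\<And>s i. s \<noteq> 0 \<Longrightarrow> \<zeta> s \<noteq> l i"
    "\<And>s. s \<noteq> 0 \<Longrightarrow> of_real s * (\<Sum>i\<in>UNIV. 1 / (\<zeta> s - l i)) = 1"
    "\<And>s. s \<noteq> 0 \<Longrightarrow> \<zeta> s \<in> mat_spectrum (T (diag_mat l) + s *\<^sub>R T J)"
    by metis
  \<comment> \<open>The sum of the \<open>1 / (\<zeta> s - l i)\<close> determines \<open>s\<close>,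
    so distinct parameters give distinct roots of \<open>det M\<close>.\<close>
  have "inj_on \<zeta> (- {0})"
  proof (rule inj_onI)
    fix s t assume "s \<in> - {0}" "t \<in> - {0}" "\<zeta> s = \<zeta> t"
    then show "s = t" using \<zeta>(2)[of s] \<zeta>(2)[of t]
      by (metis ComplD insertI1 mult_cancel_right of_real_eq_iff mult_zero_right zero_neq_one)
  qed
  moreover have "infinite (- {0::real})"
    by (simp add: Compl_eq_Diff_UNIV infinite_UNIV_char_0)
  ultimately have inf: "infinite (\<zeta> ` (- {0}))" by (simp add: finite_image_iff)
  have root: "poly (det M) (\<zeta> s) = 0" if "s \<noteq> 0" for s
  proof -
    define z where "z = \<zeta> s"
    have "poly r z = (\<Sum>i\<in>UNIV. poly psi z * (1 / (z - l i)))"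
      unfolding r_def psi_def poly_sum poly_prod
    proof (intro sum.cong refl)
      fix i
      show "(\<Prod>j\<in>UNIV - {i}. poly [:- l j, 1:] z) = (\<Prod>j\<in>UNIV. poly [:- l j, 1:] z) * (1 / (z - l i))"
        using \<zeta>(1)[OF that, of i] by (subst prod.remove[of UNIV i]) (auto simp: z_def)
    qed
    also have "\<dots> = poly psi z * (\<Sum>i\<in>UNIV. 1 / (z - l i))"
      by (simp only: sum_distrib_left)
    also have "(\<Sum>i\<in>UNIV. 1 / (z - l i)) = 1 / of_real s"
      using \<zeta>(2)[OF that] that unfolding z_def by (simp only: eq_divide_eq mult.commute) simp
    finally have r: "poly r z = poly psi z / of_real s" by simp
    have "(\<chi> i j. poly (M $ i $ j) z)
       = (\<chi> i j. (poly psi z / of_real s) * (mat z - (T (diag_mat l) + s *\<^sub>R T J)) $ i $ j)"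
      using that by (simp add: M r vec_eq_iff field_simps scaleR_conv_of_real[where 'a=complex])
    moreover have "det (mat z - (T (diag_mat l) + s *\<^sub>R T J)) = 0"
      using \<zeta>(3)[OF that] by (simp add: z_def mat_spectrum_iff_det)
    ultimately show ?thesis by (simp only: poly_det det_scale z_def[symmetric] mult_zero_right)
  qed
  have "\<zeta> ` (- {0}) \<subseteq> {z. poly (det M) z = 0}" using root by auto
  with inf have "det M = 0" using poly_roots_finite finite_subset by blast
  have psi0: "poly psi (l k) = 0" by (auto simp: psi_def poly_prod)
  \<comment> \<open>At \<open>l k\<close> only the summand of \<open>r\<close> that omits the factor
    of index \<open>k\<close> survives; it is nonzero because the \<open>l j\<close> are
    distinct.\<close>
  have "poly r (l k) = (\<Sum>i\<in>UNIV. \<Prod>j\<in>UNIV - {i}. l k - l j)"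
    by (simp add: r_def poly_sum poly_prod)
  also have "\<dots> = (\<Sum>i\<in>{k}. \<Prod>j\<in>UNIV - {i}. l k - l j)"
    by (rule sum.mono_neutral_right) auto
  finally have rk: "poly r (l k) \<noteq> 0" using injD[OF l] by auto
  have "0 = poly (det M) (l k)" by (simp add: \<open>det M = 0\<close>)
  also have "\<dots> = poly r (l k) ^ CARD('n) * det (mat (l k) - T (diag_mat l))"
    unfolding poly_det M psi0 by (simp add: det_scale[symmetric])
  finally show ?thesis using rk by (simp add: mat_spectrum_iff_det)
qed

lemma diagonalize_distinct:
  fixes A :: "complex ^ 'n ^ 'n" and l :: "'n \<Rightarrow> complex"
  assumes l: "inj l" and ev: "\<And>k. l k \<in> mat_spectrum A"
  shows "\<exists>P Q. Q ** P = mat 1 \<and> P ** Q = mat 1 \<and> A = P ** diag_mat l ** Q"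
proof -
  obtain v where v: "\<And>k. v k \<noteq> 0" "\<And>k. A *v v k = l k *s v k"
    using ev unfolding mat_spectrum_def by simp metis
  define P where "P = (\<chi> i k. v k $ i)"
  have Pc: "P *v c = (\<Sum>k\<in>UNIV. c $ k *s v k)" for c
    by (simp add: P_def vec_eq_iff matrix_vector_mult_def mult.commute)
  \<comment> \<open>Applying \<open>A - l a\<close> to a linear relation removes the term of \<open>v a\<close>.\<close>
  have ind: "\<forall>k\<in>S. c k = 0" if "finite S" "(\<Sum>k\<in>S. c k *s v k) = 0" for S c
    using that
  proof (induction S arbitrary: c rule: finite_induct)
    case (insert a S)
    have "0 = (\<Sum>k\<in>insert a S. (c k * (l k - l a)) *s v k)"
    proof -
      have "(\<Sum>k\<in>insert a S. (c k * (l k - l a)) *s v k)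
          = A *v (\<Sum>k\<in>insert a S. c k *s v k) - l a *s (\<Sum>k\<in>insert a S. c k *s v k)"
        by (simp add: vec.linear_sum[OF matrix_vector_mul_linear_gen] vector_scalar_commute v(2)
            vec.scale_sum_right sum_subtractf[symmetric] algebra_simps del: sum.insert)
      also have "\<dots> = 0" by (simp only: insert.prems) simp
      finally show ?thesis by simp
    qed
    also have "\<dots> = (\<Sum>k\<in>S. (c k * (l k - l a)) *s v k)" using insert by simp
    finally have "\<forall>k\<in>S. c k * (l k - l a) = 0" using insert.IH by metis
    moreover have "l k \<noteq> l a" if "k \<in> S" for k using injD[OF l, of k a] insert.hyps that by auto
    ultimately have z: "\<forall>k\<in>S. c k = 0" by auto
    then have "c a *s v a = 0" using insert by simp
    then show ?case using z v(1)[of a] by (auto simp: vec_eq_iff)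
  qed simp
  have "c = 0" if "P *v c = 0" for c
    using ind[of UNIV "\<lambda>k. c $ k"] that by (simp add: Pc vec_eq_iff)
  then obtain Q where Q: "Q ** P = mat 1" using matrix_left_invertible_ker by blast
  then have Q': "P ** Q = mat 1" using matrix_left_right_inverse by blast
  have "A ** P = P ** diag_mat l"
    unfolding vec_eq_iff
  proof (intro allI)
    fix i k
    have "(A ** P) $ i $ k = (A *v v k) $ i"
      by (simp add: matrix_matrix_mult_def matrix_vector_mult_def P_def)
    also have "\<dots> = (P ** diag_mat l) $ i $ k"
      by (simp add: v(2) P_def diag_mat_def matrix_matrix_mult_def if_distrib mult.commute cong: if_cong)
    finally show "(A ** P) $ i $ k = (P ** diag_mat l) $ i $ k" .
  qed
  then have "A = P ** diag_mat l ** Q"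
    by (metis Q' matrix_mul_assoc matrix_mul_rid)
  with Q Q' show ?thesis by blast
qed

text \<open>Conjugating the argument does not change its spectrum, so \<open>T\<close> composed with
  the conjugation that diagonalizes \<open>A\<close> still satisfies the hypothesis of the diagonal
  case.\<close>

lemma distinct_spectrum_transfer:
  fixes T :: "complex ^ 'n ^ 'n \<Rightarrow> complex ^ 'n ^ 'n" and l :: "'n \<Rightarrow> complex"
  assumes T: "linear T" and ov: "\<And>h. mat_spectrum (T h) \<inter> mat_spectrum h \<noteq> {}"
    and l: "inj l" and ev: "\<And>k. l k \<in> mat_spectrum A"
  shows "l k \<in> mat_spectrum (T A)"
proof -
  obtain P Q where PQ: "Q ** P = mat 1" "P ** Q = mat 1" "A = P ** diag_mat l ** Q"
    using diagonalize_distinct[OF l ev] by blast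
  have lin: "linear (\<lambda>x. P ** x ** Q)"
    by (rule linearI) (simp_all add: matrix_add_ldistrib matrix_scalar_ac scalar_matrix_assoc[symmetric]
      matrix_add_rdistrib)
  have "l k \<in> mat_spectrum ((\<lambda>x. T (P ** x ** Q)) (diag_mat l))"
    by (rule diag_spectrum_transfer[OF _ _ l])
       (use ov mat_spectrum_similarity[OF PQ(1)] linear_compose[OF lin T] in \<open>auto simp: o_def\<close>)
  then show ?thesis using PQ(3) by simp
qed

text \<open>Both matrices are similar to \<open>diag_mat l\<close>, and traces of powers are
  invariant under similarity.\<close>

lemma trace_powers_distinct:
  fixes A B :: "complex ^ 'n ^ 'n" and l :: "'n \<Rightarrow> complex"
  assumes "inj l" "\<And>k. l k \<in> mat_spectrum A" "\<And>k. l k \<in> mat_spectrum B"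
  shows "trace A = trace B" "trace (A ** A) = trace (B ** B)"
    "trace (A ** A ** A) = trace (B ** B ** B)"
proof -
  have *: "trace C = trace (diag_mat l) \<and> trace (C ** C) = trace (diag_mat l ** diag_mat l)
    \<and> trace (C ** C ** C) = trace (diag_mat l ** diag_mat l ** diag_mat l)"
    if ev: "\<And>k. l k \<in> mat_spectrum C" for C :: "complex ^ 'n ^ 'n"
  proof -
    obtain P Q where Q: "Q ** P = mat 1" and C: "C = P ** diag_mat l ** Q"
      using diagonalize_distinct[OF assms(1) ev] by blast
    have QP: "X ** Q ** P = X" for X :: "complex ^ 'n ^ 'n"
      by (metis Q matrix_mul_assoc matrix_mul_rid)
    have t: "trace (P ** X ** Q) = trace X" for X
      using trace_mul_sym[of "P ** X" Q] by (simp add: matrix_mul_assoc Q)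
    have "C ** C = P ** (diag_mat l ** diag_mat l) ** Q"
      "C ** C ** C = P ** (diag_mat l ** diag_mat l ** diag_mat l) ** Q"
      by (simp_all add: C matrix_mul_assoc QP)
    then show ?thesis using t C by simp
  qed
  show "trace A = trace B" "trace (A ** A) = trace (B ** B)"
    "trace (A ** A ** A) = trace (B ** B ** B)"
    using *[OF assms(2)] *[OF assms(3)] by simp_all
qed

section \<open>Traces of powers by perturbation of a diagonal matrix\<close>

lemma trace_scaleR: "trace (r *\<^sub>R A) = r *\<^sub>R trace A" for A :: "complex ^ 'n ^ 'n"
  by (simp add: trace_def scaleR_sum_right)

lemma scaleR_matrix_mult:
  fixes A :: "complex ^ 'm ^ 'n"
  shows "A ** (r *\<^sub>R B) = r *\<^sub>R (A ** B)" "(r *\<^sub>R A) ** B = r *\<^sub>R (A ** B)"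
  by (simp_all add: matrix_scalar_ac scalar_matrix_assoc)

lemma diag_in_spectrum: "l k \<in> mat_spectrum (diag_mat l)"
proof -
  have "diag_mat l *v axis k 1 = l k *s axis k 1"
    by (simp add: vec_eq_iff diag_mat_mult_vec axis_def)
  moreover have "axis k (1::complex) \<noteq> 0" by (simp add: axis_eq_0_iff)
  ultimately show ?thesis unfolding mat_spectrum_def by blast
qed

text \<open>\<open>D\<close> has distinct integers on its diagonal; for small \<open>r\<close> there is a root within \<open>1/3\<close> of each.\<close>

lemma perturbed_diagonal_distinct:
  fixes h :: "complex ^ 'n ^ 'n"
  obtains D :: "complex ^ 'n ^ 'n" and e :: real where "e > 0"
    "\<And>r. 0 < r \<Longrightarrow> r < e \<Longrightarrow> \<exists>l :: 'n \<Rightarrow> complex. inj l \<and> (\<forall>k. l k \<in> mat_spectrum (D + r *\<^sub>R h))"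
proof -
  obtain f :: "'n \<Rightarrow> nat" where f: "inj f"
    using finite_imp_inj_to_nat_seg[of "UNIV :: 'n set"] by auto
  define l where "l k = (of_nat (f k) :: complex)" for k
  have sep: "cmod (l j - l k) \<ge> 1" if "j \<noteq> k" for j k
  proof -
    have "l j - l k = of_int (int (f j) - int (f k))" by (simp add: l_def)
    then have "cmod (l j - l k) = of_int \<bar>int (f j) - int (f k)\<bar>" by (metis norm_of_int of_int_abs)
    moreover have "f j \<noteq> f k" using f that by (auto dest: injD)
    ultimately show ?thesis by linarith
  qed
  define A where "A r = diag_mat l + r *\<^sub>R h" for r
  have "\<forall>\<^sub>F r in at_right 0. cmod (poly (charpoly (A r)) (l k)) < (1/3) ^ CARD('n)" for k
  proof -
    have "((\<lambda>r. det (mat (l k) - A r)) \<longlongrightarrow> det (mat (l k) - (diag_mat l + 0 *\<^sub>R h))) (at_right 0)"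
      unfolding A_def by (intro tendsto_det tendsto_intros)
    then have "((\<lambda>r. poly (charpoly (A r)) (l k)) \<longlongrightarrow> 0) (at_right 0)"
      using diag_in_spectrum[of l k] by (simp add: poly_charpoly mat_spectrum_iff_det)
    then show ?thesis using order_tendstoD(2)[OF tendsto_norm_zero, of _ _ "(1/3) ^ CARD('n)"] by simp
  qed
  then have "\<forall>\<^sub>F r in at_right 0. \<forall>k. cmod (poly (charpoly (A r)) (l k)) < (1/3) ^ CARD('n)"
    by (rule eventually_all_finite)
  then obtain e :: real where e: "e > 0"
    "\<And>r k. 0 < r \<Longrightarrow> r < e \<Longrightarrow> cmod (poly (charpoly (A r)) (l k)) < (1/3) ^ CARD('n)"
    unfolding eventually_at_right_field by auto
  show ?thesis
  proof (rule that[OF e(1)])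
    fix r assume r: "0 < r" "r < e"
    have "\<exists>z. z \<in> mat_spectrum (A r) \<and> cmod (z - l k) < 1/3" for k
      using root_near[of "charpoly (A r)" "l k" "1/3"] e(2)[OF r, of k] charpoly_monic[of "A r"]
      by (auto simp: mat_spectrum_iff_det poly_charpoly)
    then obtain m where m: "\<And>k. m k \<in> mat_spectrum (A r)" "\<And>k. cmod (m k - l k) < 1/3" by metis
    have "inj m"
    proof (rule injI, rule ccontr)
      fix j k assume jk: "m j = m k" "j \<noteq> k"
      have "cmod (l j - l k) \<le> cmod (m j - l j) + cmod (m k - l k)"
        using norm_triangle_ineq4[of "m k - l k" "m j - l j"] jk(1) by (simp add: algebra_simps)
      with m(2)[of j] m(2)[of k] sep[OF jk(2)] show False by linarith
    qed
    with m(1) show "\<exists>m :: 'n \<Rightarrow> complex. inj m \<and> (\<forall>k. m k \<in> mat_spectrum (diag_mat l + r *\<^sub>R h))"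
      unfolding A_def by blast
  qed
qed

lemma cubic_coeffs_zero:
  fixes c0 c1 c2 c3 :: complex
  assumes "e > 0" and "\<And>r. 0 < r \<Longrightarrow> r < e \<Longrightarrow> c0 + r *\<^sub>R c1 + (r * r) *\<^sub>R c2 + (r * r * r) *\<^sub>R c3 = 0"
  shows "c1 = 0 \<and> c2 = 0 \<and> c3 = 0"
proof -
  have "of_real ` {0<..<e} \<subseteq> {z. poly [:c0, c1, c2, c3:] z = 0}"
  proof clarify
    fix r assume "r \<in> {0<..<e}"
    then show "poly [:c0, c1, c2, c3:] (of_real r) = 0"
      using assms(2)[of r] by (simp add: scaleR_conv_of_real algebra_simps)
  qed
  moreover have "infinite ((of_real :: real \<Rightarrow> complex) ` {0<..<e})"
    using assms(1) by (simp add: finite_image_iff inj_on_def infinite_Ioo)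
  ultimately have "[:c0, c1, c2, c3:] = 0"
    using poly_roots_finite finite_subset by blast
  then show ?thesis by simp
qed

section \<open>Linear maps sharing an eigenvalue with their argument\<close>

text \<open>Linearity is over the reals, as for a derivative in the real sense; complex linearity is
  derived in \<open>T_mat_mult\<close>.\<close>

locale eigenvalue_sharing =
  fixes T :: "complex ^ 'n ^ 'n \<Rightarrow> complex ^ 'n ^ 'n"
  assumes linear_T: "linear T"
    and common_eigenvalue: "mat_spectrum (T h) \<inter> mat_spectrum h \<noteq> {}"
begin

text \<open>For small \<open>r > 0\<close> the matrix \<open>D + r *\<^sub>R h\<close> has simple
  spectrum, which its image shares. The traces of their k-th powers are polynomials in
  \<open>r\<close> agreeing on an interval, and the coefficients of degree k involve
  \<open>h\<close> alone.\<close>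

lemma trace_powers:
  "trace (T h) = trace h" "trace (T h ** T h) = trace (h ** h)"
  "trace (T h ** T h ** T h) = trace (h ** h ** h)"
proof -
  obtain D e where e: "e > 0"
    "\<And>r. 0 < r \<Longrightarrow> r < e \<Longrightarrow> \<exists>l :: 'n \<Rightarrow> complex. inj l \<and> (\<forall>k. l k \<in> mat_spectrum (D + r *\<^sub>R h))"
    using perturbed_diagonal_distinct[where h = h] by metis
  have tr: "trace (T A) = trace A \<and> trace (T A ** T A) = trace (A ** A)
    \<and> trace (T A ** T A ** T A) = trace (A ** A ** A)"
    if r: "0 < r" "r < e" and A: "A = D + r *\<^sub>R h" for r A
  proof -
    obtain l :: "'n \<Rightarrow> complex" where l: "inj l" "\<And>k. l k \<in> mat_spectrum A"
      using e(2)[OF r] A by blast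
    show ?thesis
      using trace_powers_distinct[OF l(1) distinct_spectrum_transfer[OF linear_T common_eigenvalue l] l(2)]
      by blast
  qed
  define X where "X = T D"
  define Y where "Y = T h"
  have TA: "T (D + r *\<^sub>R h) = X + r *\<^sub>R Y" for r
    by (simp add: X_def Y_def linear_add[OF linear_T] linear_scale[OF linear_T])
  note expand = matrix_add_ldistrib matrix_add_rdistrib scaleR_matrix_mult trace_add trace_scaleR
  have "trace Y - trace h = 0"
    using cubic_coeffs_zero[OF e(1), of "trace X - trace D" "trace Y - trace h" 0 0]
      tr[OF _ _ refl] by (simp add: TA expand algebra_simps)
  then show "trace (T h) = trace h" by (simp add: Y_def)
  have "trace (Y ** Y) - trace (h ** h) = 0"
    using cubic_coeffs_zero[OF e(1), of "trace (X ** X) - trace (D ** D)"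
      "trace (X ** Y) + trace (Y ** X) - trace (D ** h) - trace (h ** D)"
      "trace (Y ** Y) - trace (h ** h)" 0]
      tr[OF _ _ refl] by (simp add: TA expand algebra_simps)
  then show "trace (T h ** T h) = trace (h ** h)" by (simp add: Y_def)
  have "trace (Y ** Y ** Y) - trace (h ** h ** h) = 0"
    using cubic_coeffs_zero[OF e(1), of "trace (X ** X ** X) - trace (D ** D ** D)"
      "trace (X ** X ** Y) + trace (X ** Y ** X) + trace (Y ** X ** X)
        - trace (D ** D ** h) - trace (D ** h ** D) - trace (h ** D ** D)"
      "trace (X ** Y ** Y) + trace (Y ** X ** Y) + trace (Y ** Y ** X)
        - trace (D ** h ** h) - trace (h ** D ** h) - trace (h ** h ** D)"
      "trace (Y ** Y ** Y) - trace (h ** h ** h)"]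
      tr[OF _ _ refl] by (simp add: TA expand algebra_simps)
  then show "trace (T h ** T h ** T h) = trace (h ** h ** h)" by (simp add: Y_def)
qed

end

section \<open>The trace form and the Jordan structure\<close>

lemma matrix_diff_distrib:
  fixes A B :: "'a::ring_1 ^ 'm ^ 'n"
  shows "C ** (A - B) = C ** A - C ** B" "(A - B) ** D = A ** D - B ** D"
  by (simp_all add: vec_eq_iff matrix_matrix_mult_def algebra_simps sum_subtractf)

lemma trace_mat_mult: "trace (mat c ** A) = c * trace A" for A :: "complex ^ 'n ^ 'n"
  by (simp add: trace_def matrix_matrix_mult_def mat_def sum_distrib_left if_distrib[of "\<lambda>t. t * _"] cong: if_cong)

lemma mat_mult_commute: "A ** mat c = mat c ** A" for A :: "complex ^ 'n ^ 'n"
  by (simp add: vec_eq_iff matrix_matrix_mult_def mat_def mult.commute if_distrib[of "\<lambda>t. t * _"]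
      if_distrib[of "times _"] cong: if_cong)

definition matrix_unit :: "'n \<Rightarrow> 'n \<Rightarrow> complex ^ 'n ^ 'n" where
  "matrix_unit i j = (\<chi> p q. if p = i \<and> q = j then 1 else 0)"

lemma matrix_mult_unit_mult: "(A ** matrix_unit k l ** B) $ i $ j = A $ i $ k * B $ l $ j"
proof -
  have "(A ** matrix_unit k l) $ i $ q = (if q = l then A $ i $ k else 0)" for q
    by (auto simp: matrix_unit_def matrix_matrix_mult_def if_distrib[of "times _"] cong: if_cong)
  then show ?thesis
    by (subst matrix_matrix_mult_def) (simp add: if_distrib[of "\<lambda>t. t * _"] cong: if_cong)
qed

lemma trace_form_nondegenerate:
  fixes A :: "complex ^ 'n ^ 'n"
  assumes "\<And>B. trace (A ** B) = 0"
  shows "A = 0"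
proof -
  have "A $ i $ j = trace (A ** matrix_unit j i)" for i j
    using matrix_mult_unit_mult[of A j i "mat 1", unfolded matrix_mul_rid]
    by (simp add: trace_def mat_def if_distrib[of "times _"] cong: if_cong)
  then show ?thesis using assms by (simp add: vec_eq_iff)
qed

context eigenvalue_sharing
begin

lemma trace_form: "trace (T a ** T b) = trace (a ** b)"
proof -
  have "trace (T (a + b) ** T (a + b)) = trace ((a + b) ** (a + b))" by (rule trace_powers)
  then show ?thesis
    using trace_mul_sym[of "T a" "T b"] trace_mul_sym[of a b] trace_powers(2)[of a] trace_powers(2)[of b]
    by (simp add: linear_add[OF linear_T] matrix_add_ldistrib matrix_add_rdistrib trace_add)
qed

lemma inj_T: "inj T"
proof -
  have "a = 0" if "T a = 0" for a
  proof (rule trace_form_nondegenerate)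
    fix b
    have "trace (a ** b) = trace (T a ** T b)" by (rule trace_form[symmetric])
    also have "\<dots> = 0" unfolding that by (simp add: trace_def)
    finally show "trace (a ** b) = 0" .
  qed
  then show ?thesis using linear_injective_0[OF linear_T] by blast
qed

lemma surj_T: "surj T"
  using linear_inj_imp_surj[OF linear_T inj_T] .

lemma trace_form_nondegenerate_T:
  assumes "\<And>b. trace (c ** T b) = 0"
  shows "c = 0"
  using trace_form_nondegenerate[of c] assms surj_T by (metis surjD)

text \<open>The isometry lets the scalar pass out of the trace, so both sides pair equally with
  every \<open>T b\<close>, and the \<open>T b\<close> exhaust the space.\<close>

lemma T_mat_mult: "T (mat c ** a) = mat c ** T a"
proof -
  have "trace ((T (mat c ** a) - mat c ** T a) ** T b) = 0" for b
    by (simp add: matrix_diff_distrib trace_sub trace_form matrix_mul_assoc[symmetric] trace_mat_mult)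
  then have "T (mat c ** a) - mat c ** T a = 0" by (rule trace_form_nondegenerate_T)
  then show ?thesis by simp
qed

text \<open>Polarizing the cubic trace identity shows that both sides pair equally with every
  \<open>T b\<close>.\<close>

lemma T_square: "T (a ** a) = T a ** T a"
proof -
  \<comment> \<open>This holds by cyclicity of the trace. Only traces of cubes occur on the right,
    and \<open>T\<close> preserves those.\<close>
  have cube: "6 * trace (x ** x ** y) = trace ((x + y) ** (x + y) ** (x + y))
      - trace ((x - y) ** (x - y) ** (x - y)) - 2 * trace (y ** y ** y)" for x y :: "complex ^ 'n ^ 'n"
    using trace_mul_sym[of x "x ** y"] trace_mul_sym[of y "x ** x"]
    by (simp add: matrix_add_ldistrib matrix_add_rdistrib matrix_diff_distrib trace_add trace_sub matrix_mul_assoc)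
  have "6 * trace (T a ** T a ** T b) = 6 * trace (a ** a ** b)" for b
    unfolding cube linear_add[OF linear_T, symmetric] linear_diff[OF linear_T, symmetric] trace_powers ..
  then have "trace ((T (a ** a) - T a ** T a) ** T b) = 0" for b
    by (simp add: matrix_diff_distrib trace_sub trace_form)
  then have "T (a ** a) - T a ** T a = 0" by (rule trace_form_nondegenerate_T)
  then show ?thesis by simp
qed

lemma T_jordan: "T (a ** b + b ** a) = T a ** T b + T b ** T a"
proof -
  have eq: "(x + y) ** (x + y) = x ** x + (x ** y + y ** x) + y ** y" for x y :: "complex ^ 'n ^ 'n"
    by (simp add: matrix_add_ldistrib matrix_add_rdistrib add_ac)
  have "T ((a + b) ** (a + b)) = (T a + T b) ** (T a + T b)"
    unfolding T_square linear_add[OF linear_T] ..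
  then show ?thesis
    unfolding eq linear_add[OF linear_T] T_square by simp
qed

text \<open>The Jordan product of \<open>a\<close> with \<open>a ** b + b ** a\<close> is
  \<open>aab + 2aba + baa\<close>. Its outer terms form the Jordan product of \<open>a ** a\<close>
  with \<open>b\<close>; removing them leaves twice \<open>aba\<close>.\<close>

lemma T_triple: "T (a ** b ** a) = T a ** T b ** T a"
proof -
  have cancel: "x + x = z + z" if "s + x + (x + t) = u + z + (z + v)" "s + t = u + v"
    for s t u v x z :: "complex ^ 'n ^ 'n"
  proof -
    have "x + x = s + x + (x + t) - (s + t)" by simp
    also have "\<dots> = z + z" unfolding that by simp
    finally show ?thesis .
  qed
  have "T (a ** (a ** b + b ** a) + (a ** b + b ** a) ** a)
      = T a ** (T a ** T b + T b ** T a) + (T a ** T b + T b ** T a) ** T a"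
    using T_jordan[of a "a ** b + b ** a"] by (simp add: T_jordan)
  moreover have "T (a ** a ** b + b ** (a ** a)) = T a ** T a ** T b + T b ** (T a ** T a)"
    using T_jordan[of "a ** a" b] by (simp add: T_square)
  ultimately have "T (a ** b ** a) + T (a ** b ** a) = T a ** T b ** T a + T a ** T b ** T a"
    unfolding linear_add[OF linear_T] matrix_add_ldistrib matrix_add_rdistrib matrix_mul_assoc
    by (rule cancel)
  then show ?thesis by (simp add: vec_eq_iff)
qed

lemma T_triple_linearized: "T (a ** b ** c + c ** b ** a) = T a ** T b ** T c + T c ** T b ** T a"
proof -
  have eq: "(x + z) ** y ** (x + z) = x ** y ** x + (x ** y ** z + z ** y ** x) + z ** y ** z"
    for x y z :: "complex ^ 'n ^ 'n"
    by (simp add: matrix_add_ldistrib matrix_add_rdistrib add_ac)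
  have "T ((a + c) ** b ** (a + c)) = (T a + T c) ** T b ** (T a + T c)"
    unfolding T_triple linear_add[OF linear_T] ..
  then show ?thesis
    unfolding eq linear_add[OF linear_T] T_triple by simp
qed

text \<open>Since \<open>T\<close> is surjective, \<open>T c\<close> in the identity
  \<open>key\<close> may be any matrix unit. This turns \<open>key\<close> into relations between
  products of entries, which force \<open>x = p\<close> or \<open>x = q\<close>.\<close>

lemma T_mult_cases: "T (a ** b) = T a ** T b \<or> T (a ** b) = T b ** T a"
proof -
  define x p q where "x = T (a ** b)" and "p = T a ** T b" and "q = T b ** T a"
  have ba: "T (b ** a) = p + q - x"
    using T_jordan[of a b] by (simp add: linear_add[OF linear_T] x_def p_def q_def algebra_simps)
  \<comment> \<open>Evaluate \<open>T (abcba + bacab)\<close> in two ways.\<close>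
  have key: "(x - p) ** T c ** (x - q) + (x - q) ** T c ** (x - p) = 0" for c
  proof -
    have "x ** T c ** (p + q - x) + (p + q - x) ** T c ** x
        = T (a ** b ** c ** (b ** a) + b ** a ** c ** (a ** b))"
      using T_triple_linearized[of "a ** b" c "b ** a"] by (simp add: ba x_def)
    also have "\<dots> = T (a ** (b ** c ** b) ** a) + T (b ** (a ** c ** a) ** b)"
      by (simp add: linear_add[OF linear_T] matrix_mul_assoc)
    also have "\<dots> = p ** T c ** q + q ** T c ** p"
      by (simp only: T_triple) (simp add: p_def q_def matrix_mul_assoc)
    finally show ?thesis
      by (simp add: matrix_diff_distrib matrix_add_ldistrib matrix_add_rdistrib algebra_simps)
  qed
  have entries: "(x - p) $ i $ k * (x - q) $ l $ j + (x - q) $ i $ k * (x - p) $ l $ j = 0" for i j k l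
  proof -
    obtain c where c: "T c = matrix_unit k l" using surj_T by (metis surjD)
    show ?thesis using arg_cong[OF key[of c], of "\<lambda>m. m $ i $ j"]
      unfolding c vector_add_component matrix_mult_unit_mult by simp
  qed
  have "x - q = 0" if "x - p \<noteq> 0"
  proof -
    obtain i k where ik: "(x - p) $ i $ k \<noteq> 0" using \<open>x - p \<noteq> 0\<close> by (metis vec_eq_iff zero_index)
    \<comment> \<open>Equal positions make the two summands of \<open>entries\<close> coincide. Once
      this entry vanishes, one summand drops out for arbitrary \<open>l\<close> and
      \<open>j\<close>.\<close>
    then have "(x - q) $ i $ k = 0" using entries[of i k i k] by (simp add: mult.commute)
    then have "(x - q) $ l $ j = 0" for l j using entries[of i k l j] ik by simp
    then show ?thesis by (simp add: vec_eq_iff)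
  qed
  then show ?thesis by (auto simp: x_def p_def q_def)
qed

end

text \<open>The argument that no group is the union of two proper subgroups: if \<open>x\<close> is
  outside the first and \<open>y\<close> outside the second, then \<open>x + y\<close> is in
  neither.\<close>

lemma union_of_two_subgroups:
  fixes P Q :: "'a::ab_group_add \<Rightarrow> bool"
  assumes P: "\<And>x y. P (x + y) \<Longrightarrow> P x \<Longrightarrow> P y" and Q: "\<And>x y. Q (x + y) \<Longrightarrow> Q x \<Longrightarrow> Q y"
    and PQ: "\<And>x. P x \<or> Q x"
  shows "(\<forall>x. P x) \<or> (\<forall>x. Q x)"
proof (rule ccontr)
  assume "\<not> ?thesis"
  then obtain x y where xy: "\<not> P x" "\<not> Q y" by auto
  with PQ have "Q x" "P y" by blast+
  then show False using PQ[of "x + y"] P[of y x] Q[of x y] xy by (auto simp: add.commute)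
qed

text \<open>The alternative for single pairs is made uniform twice: in \<open>b\<close> for fixed
  \<open>a\<close>, then in \<open>a\<close>.\<close>

lemma (in eigenvalue_sharing) T_hom_or_antihom:
  "(\<forall>a b. T (a ** b) = T a ** T b) \<or> (\<forall>a b. T (a ** b) = T b ** T a)"
proof (rule union_of_two_subgroups)
  note expand = linear_add[OF linear_T] matrix_add_ldistrib matrix_add_rdistrib
  show "(\<forall>b. T (a ** b) = T a ** T b) \<or> (\<forall>b. T (a ** b) = T b ** T a)" for a
    by (rule union_of_two_subgroups) (use T_mult_cases[of a] in \<open>simp_all add: expand\<close>)
qed (simp_all add: linear_add[OF linear_T] matrix_add_ldistrib matrix_add_rdistrib)

text \<open>A case of the Skolem-Noether theorem: an explicit intertwiner of the standard action
  with the action through \<open>\<phi>\<close> has trivial kernel.\<close>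

lemma matrix_algebra_hom_inner:
  fixes \<phi> :: "complex ^ 'n ^ 'n \<Rightarrow> complex ^ 'n ^ 'n"
  assumes add: "\<And>a b. \<phi> (a + b) = \<phi> a + \<phi> b" and scale: "\<And>c a. \<phi> (mat c ** a) = mat c ** \<phi> a"
    and mult: "\<And>a b. \<phi> (a ** b) = \<phi> a ** \<phi> b" and inj: "inj \<phi>"
  shows "\<exists>u. invertible u \<and> (\<forall>x. \<phi> x = u ** x ** matrix_inv u)"
proof -
  fix k :: 'n
  \<comment> \<open>\<open>R v\<close> has \<open>v\<close> as its \<open>k\<close>-th column, so \<open>u v = \<phi> (R v) w\<close> intertwines: \<open>\<phi> x (u v) = \<phi> (x R v) w = u (x v)\<close>.\<close>
  define R :: "complex ^ 'n \<Rightarrow> complex ^ 'n ^ 'n" where "R v = (\<chi> i j. if j = k then v $ i else 0)" for v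
  have R: "R (v + w) = R v + R w" "R (c *s v) = mat c ** R v" "R (A *v v) = A ** R v" for v w c A
    by (auto simp: R_def vec_eq_iff matrix_matrix_mult_def matrix_vector_mult_def mat_def
        if_distrib[of "\<lambda>t. t * _"] cong: if_cong)
  have "\<phi> 0 = 0" using add[of 0 0] by simp
  moreover have "R (axis k 1) \<noteq> 0"
  proof
    assume "R (axis k 1) = 0"
    then have "R (axis k 1) $ k $ k = 0" by simp
    then show False by (simp add: R_def)
  qed
  ultimately have "\<phi> (R (axis k 1)) \<noteq> 0" using inj by (metis injD)
  then obtain w where w: "\<phi> (R (axis k 1)) *v w \<noteq> 0"
    by (metis matrix_eq matrix_vector_mult_0)
  define u where "u = matrix (\<lambda>v. \<phi> (R v) *v w)"
  have "Vector_Spaces.linear (*s) (*s) (\<lambda>v. \<phi> (R v) *v w)"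
    by (intro Vector_Spaces.linear.intro vec.vector_space_axioms module_hom.intro)
       (simp_all add: R add scale matrix_vector_mult_add_rdistrib matrix_vector_mul_assoc[symmetric] mat_mult_vec
         vec.module_axioms module_hom_axioms_def)
  then have u: "u *v v = \<phi> (R v) *v w" for v unfolding u_def by (rule matrix_works)
  have comm: "\<phi> x ** u = u ** x" for x
    by (simp add: matrix_eq matrix_vector_mul_assoc[symmetric] u R mult)
  have "v = 0" if v: "u *v v = 0" for v
  proof (rule ccontr)
    assume "v \<noteq> 0"
    then obtain i where i: "v $ i \<noteq> 0" by (metis vec_eq_iff zero_index)
    \<comment> \<open>This matrix sends \<open>v\<close> to \<open>axis k 1\<close>, so by the
      intertwining \<open>axis k 1\<close> is also in the kernel of \<open>u\<close>, contrary to
      the choice of \<open>w\<close>.\<close>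
    define x where "x = (\<chi> p q. if p = k \<and> q = i then 1 / v $ i else 0)"
    have "x *v v = axis k 1"
      by (auto simp: vec_eq_iff x_def matrix_vector_mult_def axis_def i if_distrib[of "\<lambda>t. t * _"] cong: if_cong)
    then have "u *v axis k 1 = \<phi> x *v (u *v v)" by (metis comm matrix_vector_mul_assoc)
    with v u[of "axis k 1"] w show False by simp
  qed
  then have inv: "invertible u"
    using matrix_left_invertible_ker[of u] invertible_left_inverse by blast
  then have inv'_u: "u ** matrix_inv u = mat 1"
    unfolding invertible_def matrix_inv_def by (rule someI_ex[THEN conjunct1])
  have "\<phi> x = u ** x ** matrix_inv u" for x
    using comm[of x] inv'_u by (metis matrix_mul_assoc matrix_mul_rid)
  with inv show ?thesis by blast
qed

lemma (in eigenvalue_sharing) T_inner_or_transpose: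
  "\<exists>u. invertible u \<and>
    ((\<forall>x. T x = u ** x ** matrix_inv u) \<or> (\<forall>x. T x = u ** transpose x ** matrix_inv u))"
  using T_hom_or_antihom
proof
  assume "\<forall>a b. T (a ** b) = T a ** T b"
  then show ?thesis
    using matrix_algebra_hom_inner[of T] linear_add[OF linear_T] T_mat_mult inj_T by metis
next
  assume anti: "\<forall>a b. T (a ** b) = T b ** T a"
  \<comment> \<open>Precomposing with the transpose turns the antihomomorphism into a
    homomorphism.\<close>
  have "\<exists>u. invertible u \<and> (\<forall>x. T (transpose x) = u ** x ** matrix_inv u)"
  proof (rule matrix_algebra_hom_inner)
    show "T (transpose (a + b)) = T (transpose a) + T (transpose b)" for a b
      by (simp add: linear_add[OF linear_T, symmetric] transpose_def vec_eq_iff)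
         (simp add: plus_vec_def)
    show "T (transpose (mat c ** a)) = mat c ** T (transpose a)" for c a
      by (simp add: matrix_transpose_mul transpose_mat mat_mult_commute T_mat_mult)
    show "T (transpose (a ** b)) = T (transpose a) ** T (transpose b)" for a b
      by (simp add: matrix_transpose_mul anti)
    show "inj (\<lambda>x. T (transpose x))"
      by (rule injI) (simp add: inj_eq[OF inj_T] transpose_iff)
  qed
  then obtain u where "invertible u" "\<And>x. T (transpose x) = u ** x ** matrix_inv u" by blast
  then show ?thesis using transpose_transpose by (metis (no_types))
qed

section \<open>From the derivative to the map\<close>

lemma has_vector_derivative_iff_quotient:
  "(f has_vector_derivative D) (at x) \<longleftrightarrow> ((\<lambda>t. (f (x + t) - f x) /\<^sub>R t) \<longlongrightarrow> D) (at 0)"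
proof -
  have "(f has_vector_derivative D) (at x)
      \<longleftrightarrow> ((\<lambda>t. norm (f (x + t) - f x - t *\<^sub>R D) / norm t) \<longlongrightarrow> 0) (at 0)"
    unfolding has_vector_derivative_def has_derivative_at by (simp add: bounded_linear_scaleR_left)
  also have "\<dots> \<longleftrightarrow> ((\<lambda>t. norm ((f (x + t) - f x) /\<^sub>R t - D)) \<longlongrightarrow> 0) (at 0)"
  proof (rule filterlim_cong[OF refl refl])
    show "\<forall>\<^sub>F t in at 0. norm (f (x + t) - f x - t *\<^sub>R D) / norm t = norm ((f (x + t) - f x) /\<^sub>R t - D)"
    proof (rule eventually_mono[OF eventually_neq_at_within[of 0]])
      fix t :: real assume "t \<noteq> 0"
      then have "(f (x + t) - f x) /\<^sub>R t - D = (f (x + t) - f x - t *\<^sub>R D) /\<^sub>R t"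
        by (simp add: scaleR_diff_right)
      then show "norm (f (x + t) - f x - t *\<^sub>R D) / norm t = norm ((f (x + t) - f x) /\<^sub>R t - D)"
        by (simp add: divide_inverse_commute)
    qed
  qed
  also have "\<dots> \<longleftrightarrow> ((\<lambda>t. (f (x + t) - f x) /\<^sub>R t) \<longlongrightarrow> D) (at 0)"
    by (simp add: tendsto_norm_zero_iff LIM_zero_iff)
  finally show ?thesis .
qed

lemma has_derivative_along_line:
  assumes "(F has_derivative L) (at x)"
  shows "((\<lambda>t. (F (x + t *\<^sub>R h) - F x) /\<^sub>R t) \<longlongrightarrow> L h) (at 0)"
proof -
  have "((\<lambda>t. F (x + t *\<^sub>R h)) has_derivative (\<lambda>t. L (t *\<^sub>R h))) (at 0)"
    by (rule has_derivative_compose[of _ _ _ _ F L]) (use assms in \<open>auto intro!: derivative_eq_intros\<close>)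
  then have "((\<lambda>t. F (x + t *\<^sub>R h)) has_vector_derivative L h) (at 0)"
    using linear_scale[OF has_derivative_linear[OF assms]] by (simp add: has_vector_derivative_def)
  then show ?thesis by (simp add: has_vector_derivative_iff_quotient)
qed

text \<open>Scaling by \<open>1 / t\<close> makes each difference quotient \<open>q t\<close> share
  an eigenvalue with \<open>h\<close>. If the limit \<open>L h\<close> shared none, continuity of
  the determinant would exclude each of the finitely many eigenvalues of \<open>h\<close> for small
  \<open>t\<close>.\<close>

lemma eigenvalue_sharing_derivative:
  fixes F :: "complex ^ 'n ^ 'n \<Rightarrow> complex ^ 'n ^ 'n"
  assumes U: "open U" "x \<in> U" and F: "(F has_derivative L) (at x)"
    and ov: "\<And>y. y \<in> U \<Longrightarrow> mat_spectrum (F y - F x) \<inter> mat_spectrum (y - x) \<noteq> {}"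
  shows "eigenvalue_sharing L"
proof (rule eigenvalue_sharing.intro)
  show "linear L" using F by (rule has_derivative_linear)
  fix h
  define q where "q t = (F (x + t *\<^sub>R h) - F x) /\<^sub>R t" for t
  have q: "(q \<longlongrightarrow> L h) (at_right 0)"
    unfolding q_def by (rule tendsto_mono[OF at_within_le_at has_derivative_along_line[OF F]])
  have "((\<lambda>t. x + t *\<^sub>R h) \<longlongrightarrow> x + 0 *\<^sub>R h) (at_right 0)" by (intro tendsto_intros)
  then have "\<forall>\<^sub>F t in at_right 0. x + t *\<^sub>R h \<in> U"
    using topological_tendstoD U by fastforce
  with eventually_at_right_less[of "0::real"] have ev: "\<forall>\<^sub>F t in at_right 0. \<exists>z\<in>mat_spectrum h. det (mat z - q t) = 0"
  proof eventually_elim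
    case (elim t)
    obtain z where z: "z \<in> mat_spectrum (t *\<^sub>R q t)" "z \<in> mat_spectrum (t *\<^sub>R h)"
      using ov[OF elim(2)] elim(1) by (auto simp: q_def)
    then have "z / of_real t \<in> mat_spectrum (q t) \<and> z / of_real t \<in> mat_spectrum h"
      using mat_spectrum_scale elim(1) by blast
    then show ?case by (auto simp: mat_spectrum_iff_det)
  qed
  show "mat_spectrum (L h) \<inter> mat_spectrum h \<noteq> {}"
  proof
    assume empty: "mat_spectrum (L h) \<inter> mat_spectrum h = {}"
    have "\<forall>\<^sub>F t in at_right 0. det (mat z - q t) \<noteq> 0" if "z \<in> mat_spectrum h" for z
    proof (rule tendsto_imp_eventually_ne)
      show "((\<lambda>t. det (mat z - q t)) \<longlongrightarrow> det (mat z - L h)) (at_right 0)"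
        by (intro tendsto_det tendsto_diff tendsto_const q)
      show "det (mat z - L h) \<noteq> 0" using empty that by (auto simp: mat_spectrum_iff_det)
    qed
    then have "\<forall>\<^sub>F t in at_right 0. \<forall>z\<in>mat_spectrum h. det (mat z - q t) \<noteq> 0"
      by (intro eventually_ball_finite finite_mat_spectrum) auto
    with ev have "\<forall>\<^sub>F t in at_right (0::real). False" by eventually_elim auto
    then show False by simp
  qed
qed

text \<open>Uniform continuity of \<open>F'\<close> on the compact ball bounds the linearization
  error on the segment from \<open>z\<close> to \<open>z + r m *\<^sub>R a\<close> independently of
  \<open>z\<close>.\<close>

lemma difference_quotient_uniform_limit:
  fixes F :: "'a::euclidean_space \<Rightarrow> 'b::real_normed_vector" and F' :: "'a \<Rightarrow> 'a \<Rightarrow>\<^sub>L 'b"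
  assumes F: "\<And>x. x \<in> cball x0 R \<Longrightarrow> (F has_derivative blinfun_apply (F' x)) (at x)"
    and cont: "continuous_on (cball x0 R) F'"
    and r: "\<And>m. r m > 0" "r \<longlonglongrightarrow> 0" and S: "S \<subseteq> cball x0 (R / 2)" and R: "R > 0"
  shows "uniform_limit S (\<lambda>m z. (F (z + r m *\<^sub>R a) - F z) /\<^sub>R r m) (\<lambda>z. F' z a) sequentially"
proof (rule uniform_limitI)
  fix e :: real assume e: "e > 0"
  define e' where "e' = e / (norm a + 1)"
  have "e' > 0" using e by (simp add: e'_def add_nonneg_pos)
  then obtain d where d: "d > 0"
    "\<And>y z. y \<in> cball x0 R \<Longrightarrow> z \<in> cball x0 R \<Longrightarrow> dist y z < d \<Longrightarrow> dist (F' y) (F' z) < e'"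
    using compact_uniformly_continuous[OF cont compact_cball] unfolding uniformly_continuous_on_def by metis
  have "(\<lambda>m. norm (r m *\<^sub>R a)) \<longlonglongrightarrow> norm (0 *\<^sub>R a)" by (intro tendsto_intros r)
  \<comment> \<open>The bound \<open>R / 2\<close> keeps the segment inside the ball of radius
    \<open>R\<close>, and \<open>d\<close> keeps it in the range of uniform continuity.\<close>
  then have "\<forall>\<^sub>F m in sequentially. norm (r m *\<^sub>R a) < min d (R / 2)"
    by (rule order_tendstoD) (use d R in auto)
  then show "\<forall>\<^sub>F m in sequentially. \<forall>z\<in>S. dist ((F (z + r m *\<^sub>R a) - F z) /\<^sub>R r m) (F' z a) < e"
  proof eventually_elim
    case (elim m)
    show ?case
    proof
      fix z assume "z \<in> S"
      then have z: "dist x0 z \<le> R / 2" using S by auto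
      define b where "b = z + r m *\<^sub>R a"
      define C where "C = closed_segment z b"
      have C: "w \<in> cball x0 R \<and> dist w z < d" if "w \<in> C" for w
      proof -
        have "dist w z \<le> dist b z" using that dist_in_closed_segment[of w z b] by (simp add: C_def dist_commute)
        also have "\<dots> < min d (R / 2)" using elim by (simp add: b_def dist_norm)
        finally show ?thesis using z dist_triangle[of x0 w z] by (simp add: dist_commute)
      qed
      have "norm (F b - F z - F' z (b - z)) \<le> norm (b - z) * e'"
      proof (rule differentiable_bound_linearization)
        show "z + t *\<^sub>R (b - z) \<in> C" if "t \<in> {0..1}" for t
          using that by (auto simp: C_def closed_segment_def algebra_simps intro!: exI[of _ t])
        show "(F has_derivative blinfun_apply (F' w)) (at w within C)" if "w \<in> C" for w
          using F C[OF that] has_derivative_at_withinI by blast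
        show "z \<in> C" by (simp add: C_def)
        show "onorm (blinfun_apply (F' w) - blinfun_apply (F' z)) \<le> e'" if "w \<in> C" for w
        proof -
          have "dist (F' w) (F' z) < e'" using d(2) C[OF that] C[of z] by (simp add: C_def)
          then show ?thesis
            by (simp add: dist_norm norm_blinfun.rep_eq minus_blinfun.rep_eq fun_diff_def)
        qed
      qed
      then have "norm (F b - F z - r m *\<^sub>R F' z a) \<le> r m * (norm a * e')"
        using r(1)[of m] by (simp add: b_def blinfun.scaleR_right)
      moreover have "F b - F z - r m *\<^sub>R F' z a = r m *\<^sub>R ((F b - F z) /\<^sub>R r m - F' z a)"
        using r(1)[of m] by (simp add: scaleR_diff_right)
      ultimately have "r m * dist ((F b - F z) /\<^sub>R r m) (F' z a) \<le> r m * (norm a * e')"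
        using r(1)[of m] by (simp add: dist_norm)
      then have "dist ((F b - F z) /\<^sub>R r m) (F' z a) \<le> norm a * e'" using r(1)[of m] by simp
      also have "norm a * e' < (norm a + 1) * e'" using \<open>e' > 0\<close> by simp
      also have "\<dots> = e" unfolding e'_def using norm_ge_zero[of a] by (simp add: add_nonneg_eq_0_iff)
      finally show "dist ((F (z + r m *\<^sub>R a) - F z) /\<^sub>R r m) (F' z a) < e" by (simp add: b_def)
    qed
  qed
qed

section \<open>Holomorphy along complex lines and second derivatives\<close>

lemma mat_mult_component: "(mat s ** b) $ i $ j = s * b $ i $ j" for b :: "'a::semiring_1 ^ 'm ^ 'n"
  by (simp add: mat_def matrix_matrix_mult_def if_distrib[of "\<lambda>t. t * _"] cong: if_cong)

lemma bounded_linear_mat_mult: "bounded_linear (\<lambda>s :: complex. mat s ** b)" for b :: "complex ^ 'n ^ 'n"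
  unfolding linear_conv_bounded_linear[symmetric]
  by (rule linearI) (simp_all add: vec_eq_iff mat_mult_component algebra_simps)

lemma mat_of_real_mult: "mat (of_real t) ** b = t *\<^sub>R b" for b :: "complex ^ 'n ^ 'n"
  by (simp add: vec_eq_iff mat_mult_component scaleR_conv_of_real[where 'a = complex])

text \<open>Complex linearity of \<open>L\<close> makes the real derivative in \<open>s\<close> a
  multiplication by the complex number \<open>L b $ i $ j\<close>.\<close>

lemma has_field_derivative_along_complex_line:
  fixes F L :: "complex ^ 'n ^ 'n \<Rightarrow> complex ^ 'n ^ 'n"
  assumes F: "(F has_derivative L) (at (c + mat s ** b))"
    and L: "\<And>z a. L (mat z ** a) = mat z ** L a"
  shows "((\<lambda>s. F (c + mat s ** b) $ i $ j) has_field_derivative L b $ i $ j) (at s)"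
proof -
  have "((\<lambda>s. c + mat s ** b) has_derivative (\<lambda>s. mat s ** b)) (at s)"
    using has_derivative_add[OF has_derivative_const bounded_linear_imp_has_derivative[OF bounded_linear_mat_mult]]
    by simp
  from has_derivative_compose[OF this F]
  have "((\<lambda>s. F (c + mat s ** b)) has_derivative (\<lambda>s. mat s ** L b)) (at s)" by (simp add: L)
  then have "((\<lambda>s. F (c + mat s ** b) $ i $ j) has_derivative (\<lambda>s. (mat s ** L b) $ i $ j)) (at s)"
    by (intro bounded_linear.has_derivative[OF bounded_linear_vec_nth])
  moreover have "(mat s ** L b) $ i $ j = L b $ i $ j * s" for s
    by (simp add: mat_mult_component)
  ultimately show ?thesis by (simp add: has_field_derivative_def)
qed

locale eigenvalue_sharing_derivatives =
  fixes U :: "(complex ^ 'n ^ 'n) set" and F :: "complex ^ 'n ^ 'n \<Rightarrow> complex ^ 'n ^ 'n"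
    and F' :: "complex ^ 'n ^ 'n \<Rightarrow> (complex ^ 'n ^ 'n) \<Rightarrow>\<^sub>L (complex ^ 'n ^ 'n)"
  assumes open_U: "open U"
    and derivative: "x \<in> U \<Longrightarrow> (F has_derivative blinfun_apply (F' x)) (at x)"
    and continuous_derivative: "continuous_on U F'"
    and sharing: "x \<in> U \<Longrightarrow> eigenvalue_sharing (blinfun_apply (F' x))"
begin

text \<open>
  The difference quotients of \<open>F\<close> in direction \<open>a\<close> are holomorphic along the complex line in direction
  \<open>b\<close> and converge uniformly, so by Weierstrass their derivatives converge to the derivative of the
  limit; this is what makes the second derivative symmetric.
\<close>

lemma mixed_derivative_exists:
  assumes "x \<in> U"
  obtains D r where "((\<lambda>t. F' (x + t *\<^sub>R b) a) has_vector_derivative D) (at 0)"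
    and "\<And>m. r m > 0" "r \<longlonglongrightarrow> 0" "(\<lambda>m. (F' (x + r m *\<^sub>R a) b - F' x b) /\<^sub>R r m) \<longlonglongrightarrow> D"
proof -
  obtain R where R: "R > 0" "cball x R \<subseteq> U" using open_U assms open_contains_cball by blast
  define N where "N = norm a + 1"
  \<comment> \<open>Since \<open>N\<close> exceeds \<open>norm a\<close>, every step
    \<open>r m *\<^sub>R a\<close> has length at most \<open>R / 2\<close>.\<close>
  define r where "r m = R / (2 * N) / real (Suc m)" for m
  have pos: "N > 0" by (simp add: N_def add_nonneg_pos)
  then have r0: "r m > 0" for m using R by (simp add: r_def)
  have rlim: "r \<longlonglongrightarrow> 0"
    unfolding r_def using LIMSEQ_Suc[OF lim_const_over_n[of "R / (2 * N)"]] .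
  have ra: "norm (r m *\<^sub>R a) \<le> R / 2" for m
  proof -
    have "r m \<le> R / (2 * N) / 1" unfolding r_def
      using R pos by (intro divide_left_mono) auto
    then have "r m \<le> R / (2 * N)" by (simp only: div_by_1)
    then have "r m * norm a \<le> R / (2 * N) * N"
      by (rule mult_mono) (use r0[of m] R pos in \<open>auto simp: N_def\<close>)
    then have "norm (r m *\<^sub>R a) \<le> R / (2 * N) * N"
      using r0[of m] by simp
    also have "\<dots> = R / 2" using pos by simp
    finally show ?thesis .
  qed
  obtain K where K: "K > 0" "\<And>s. norm (mat s ** b) \<le> norm (s :: complex) * K"
    using bounded_linear.pos_bounded[OF bounded_linear_mat_mult] by blast
  \<comment> \<open>With this radius \<open>p\<close> maps the disc into
    \<open>cball x (R / 2)\<close>, so a further step \<open>r m *\<^sub>R a\<close> stays in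
    \<open>U\<close>.\<close>
  define S where "S = ball (0 :: complex) (R / (2 * K))"
  define p where "p s = x + mat s ** b" for s :: complex
  have p: "p s \<in> cball x (R / 2)" if "s \<in> S" for s
  proof -
    have "norm (mat s ** b) \<le> R / (2 * K) * K"
      using K(2)[of s] that K(1) by (intro order_trans[OF K(2)] mult_right_mono) (auto simp: S_def)
    then show ?thesis using K(1) by (simp add: p_def dist_norm)
  qed
  have pr: "p s + r m *\<^sub>R a \<in> U" "p s \<in> U" if "s \<in> S" for s m
  proof -
    have "dist x (p s + r m *\<^sub>R a) \<le> dist x (p s) + norm (r m *\<^sub>R a)"
      by (rule order_trans[OF dist_triangle[of _ _ "p s"]]) (simp add: dist_norm)
    then show "p s + r m *\<^sub>R a \<in> U" "p s \<in> U"
      using R p[OF that] ra[of m] by (auto simp: subset_iff)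
  qed
  define f where "f m z = (F (z + r m *\<^sub>R a) - F z) /\<^sub>R r m" for m z
  define f' where "f' m z = (F' (z + r m *\<^sub>R a) b - F' z b) /\<^sub>R r m" for m z
  have "uniform_limit (p ` S) f (\<lambda>z. F' z a) sequentially"
    unfolding f_def
    by (rule difference_quotient_uniform_limit[where R = R and ?x0.0 = x])
       (use p R derivative continuous_on_subset[OF continuous_derivative] r0 rlim in auto)
  then have "uniform_limit S (\<lambda>m s. f m (p s)) (\<lambda>s. F' (p s) a) sequentially"
    by (simp add: uniform_limit_iff)
  then have unif: "uniform_limit S (\<lambda>m s. f m (p s) $ i $ j) (\<lambda>s. F' (p s) a $ i $ j) sequentially" for i j
    by (intro bounded_linear.uniform_limit[OF bounded_linear_vec_nth])
  have f': "((\<lambda>s. f m (p s) $ i $ j) has_field_derivative f' m (p s) $ i $ j) (at s)" if s: "s \<in> S" for m s i j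
  proof -
    have line: "((\<lambda>s. F (c + mat s ** b) $ i $ j) has_field_derivative F' (c + mat s ** b) b $ i $ j) (at s)"
      if "c + mat s ** b \<in> U" for c
      by (rule has_field_derivative_along_complex_line[OF derivative[OF that]
            eigenvalue_sharing.T_mat_mult[OF sharing[OF that]]])
    have "x + mat s ** b \<in> U" "x + r m *\<^sub>R a + mat s ** b \<in> U"
      using pr(1)[OF s, of m] pr(2)[OF s] by (simp_all add: p_def algebra_simps)
    note this[THEN line]
    then show ?thesis
      unfolding f_def f'_def p_def
      by (auto simp: scaleR_conv_of_real[where 'a = complex] algebra_simps intro!: derivative_eq_intros)
  qed
  have "\<exists>g'. \<forall>s\<in>S. ((\<lambda>s. F' (p s) a $ i $ j) has_field_derivative g' s) (at s)
      \<and> (\<lambda>m. f' m (p s) $ i $ j) \<longlonglongrightarrow> g' s" for i j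
  proof (rule has_complex_derivative_uniform_sequence[where f = "\<lambda>m s. f m (p s) $ i $ j"])
    show "open S" by (simp add: S_def)
    show "\<exists>d>0. cball s d \<subseteq> S \<and>
        uniform_limit (cball s d) (\<lambda>m s. f m (p s) $ i $ j) (\<lambda>s. F' (p s) a $ i $ j) sequentially"
      if "s \<in> S" for s
      using open_contains_cball \<open>open S\<close> that uniform_limit_on_subset[OF unif] by metis
  qed (rule f')
  moreover have "0 \<in> S" using R K by (simp add: S_def)
  ultimately have "\<exists>d. ((\<lambda>s. F' (p s) a $ i $ j) has_field_derivative d) (at 0)
      \<and> (\<lambda>m. f' m (p 0) $ i $ j) \<longlonglongrightarrow> d" for i j
    by blast
  then obtain d where d: "\<And>i j. ((\<lambda>s. F' (p s) a $ i $ j) has_field_derivative d i j) (at 0)"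
    "\<And>i j. (\<lambda>m. f' m (p 0) $ i $ j) \<longlonglongrightarrow> d i j" by metis
  define D where "D = (\<chi> i j. d i j)"
  \<comment> \<open>For real parameters \<open>p\<close> runs along the real line
    \<open>x + t *\<^sub>R b\<close>, so the complex derivative restricts to the real one.\<close>
  have "((\<lambda>t. F' (x + t *\<^sub>R b) a $ i $ j) has_vector_derivative D $ i $ j) (at 0)" for i j
    using has_vector_derivative_real_field[of "\<lambda>s. F' (p s) a $ i $ j" "d i j" 0] d(1)[of i j]
    by (simp add: p_def mat_of_real_mult D_def)
  then have "((\<lambda>t. F' (x + t *\<^sub>R b) a) has_vector_derivative D) (at 0)"
    unfolding has_vector_derivative_iff_quotient by (intro vec_tendstoI) simp
  moreover have "(\<lambda>m. f' m (p 0)) \<longlonglongrightarrow> D"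
    by (intro vec_tendstoI) (simp add: D_def d)
  ultimately show ?thesis
    using that[OF _ r0 rlim] by (simp add: f'_def p_def)
qed

definition D2 :: "complex ^ 'n ^ 'n \<Rightarrow> complex ^ 'n ^ 'n \<Rightarrow> complex ^ 'n ^ 'n \<Rightarrow> complex ^ 'n ^ 'n" where
  "D2 x a b = vector_derivative (\<lambda>t. F' (x + t *\<^sub>R b) a) (at 0)"

lemma has_derivative_D2:
  assumes "x \<in> U"
  shows "((\<lambda>t. F' (x + t *\<^sub>R b) a) has_vector_derivative D2 x a b) (at 0)"
proof -
  obtain D where "((\<lambda>t. F' (x + t *\<^sub>R b) a) has_vector_derivative D) (at 0)"
    by (rule mixed_derivative_exists[OF assms])
  then show ?thesis unfolding D2_def using vector_derivative_at by metis
qed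

text \<open>The same \<open>D\<close> is the derivative of \<open>F'\<close> applied to
  \<open>a\<close> in direction \<open>b\<close> and a sequential limit of difference quotients of
  \<open>F'\<close> applied to \<open>b\<close> in direction \<open>a\<close>. The latter are known
  to converge to \<open>D2 x b a\<close>.\<close>

lemma D2_commute:
  assumes "x \<in> U"
  shows "D2 x a b = D2 x b a"
proof -
  obtain D r where D: "((\<lambda>t. F' (x + t *\<^sub>R b) a) has_vector_derivative D) (at 0)"
    and r: "\<And>m. r m > 0" "r \<longlonglongrightarrow> 0" "(\<lambda>m. (F' (x + r m *\<^sub>R a) b - F' x b) /\<^sub>R r m) \<longlonglongrightarrow> D"
    by (rule mixed_derivative_exists[OF assms, where a = a and b = b]) blast
  have "filterlim r (at 0) sequentially"
    unfolding filterlim_at using r(2) less_imp_neq[OF r(1)] by (auto intro!: always_eventually)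
  moreover have "((\<lambda>t. (F' (x + t *\<^sub>R a) b - F' x b) /\<^sub>R t) \<longlongrightarrow> D2 x b a) (at 0)"
    using has_derivative_D2[OF assms, of a b] by (simp add: has_vector_derivative_iff_quotient)
  ultimately have "(\<lambda>m. (F' (x + r m *\<^sub>R a) b - F' x b) /\<^sub>R r m) \<longlonglongrightarrow> D2 x b a"
    by (rule filterlim_compose[rotated])
  with r(3) have "D = D2 x b a" by (rule LIMSEQ_unique)
  moreover have "D = D2 x a b" using D has_derivative_D2[OF assms] vector_derivative_unique_at by blast
  ultimately show ?thesis by simp
qed

lemma bounded_bilinear_trace_form: "bounded_bilinear (\<lambda>A B :: complex ^ 'n ^ 'n. trace (A ** B))"
  unfolding bilinear_conv_bounded_bilinear[symmetric] bilinear_def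
  by (auto intro!: linearI simp: matrix_add_ldistrib matrix_add_rdistrib scaleR_matrix_mult trace_add trace_scaleR)

text \<open>Product rule for the trace form of the images of \<open>a\<close> and \<open>c\<close>
  along direction \<open>b\<close>; that form is constant because each derivative is an
  isometry.\<close>

lemma D2_skew:
  assumes "x \<in> U"
  shows "trace (F' x a ** D2 x c b) + trace (D2 x a b ** F' x c) = 0"
proof -
  have "continuous_on UNIV (\<lambda>t::real. x + t *\<^sub>R b)" by (intro continuous_intros)
  then have op: "open ((\<lambda>t::real. x + t *\<^sub>R b) -` U)" using open_U by (simp add: continuous_on_open_vimage)
  have "((\<lambda>t. trace (F' (x + t *\<^sub>R b) a ** F' (x + t *\<^sub>R b) c)) has_vector_derivative
      trace (F' x a ** D2 x c b) + trace (D2 x a b ** F' x c)) (at 0)"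
    using bounded_bilinear.has_vector_derivative[OF bounded_bilinear_trace_form
        has_derivative_D2[OF assms, where b = b and a = a] has_derivative_D2[OF assms, where b = b and a = c]]
    by simp
  then have "((\<lambda>t. trace (a ** c)) has_vector_derivative
      trace (F' x a ** D2 x c b) + trace (D2 x a b ** F' x c)) (at (0::real))"
    by (rule has_vector_derivative_transform_within_open[OF _ op])
       (use assms in \<open>simp_all add: eigenvalue_sharing.trace_form[OF sharing]\<close>)
  then show ?thesis
    using has_vector_derivative_const vector_derivative_unique_at by blast
qed

lemma D2_zero:
  assumes "x \<in> U"
  shows "D2 x a b = 0"
proof (rule eigenvalue_sharing.trace_form_nondegenerate_T[OF sharing[OF assms]])
  fix c
  define S where "S a b c = trace (D2 x a b ** F' x c)" for a b c
  have sym: "S a b c = S b a c" for a b c using D2_commute[OF assms] by (simp add: S_def)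
  have skew: "S a b c = - S c b a" for a b c
    using D2_skew[OF assms, of a c b] trace_mul_sym[of "F' x a" "D2 x c b"]
    by (simp add: S_def eq_neg_iff_add_eq_0 add.commute)
  \<comment> \<open>Alternating the rules: \<open>S a b c = - S c b a = - S b c a = S a c b = S c a
    b = - S b a c = - S a b c\<close>.\<close>
  have "S a b c = - S a b c"
    by (metis sym skew)
  then show "trace (D2 x a b ** F' x c) = 0" by (simp add: S_def)
qed

lemma derivative_constant:
  assumes "connected U" "x \<in> U" "y \<in> U"
  shows "F' x = F' y"
proof (rule connected_local_const[OF assms], intro ballI)
  fix z assume "z \<in> U"
  then obtain e where e: "e > 0" "ball z e \<subseteq> U" using open_U open_contains_ball by blast
  have "F' z a = F' w a" if w: "w \<in> ball z e" for w a
  proof -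
    define b where "b = w - z"
    have "((\<lambda>t. F' (z + t *\<^sub>R b) a) has_vector_derivative 0) (at t within {0..1})" if t: "t \<in> {0..1}" for t
    proof -
      have "closed_segment z w \<subseteq> ball z e" using w e(1) by (intro closed_segment_subset) auto
      moreover have "z + t *\<^sub>R b \<in> closed_segment z w"
        using t by (auto simp: closed_segment_def b_def algebra_simps intro!: exI[of _ t])
      ultimately have "z + t *\<^sub>R b \<in> U" using e by blast
      \<comment> \<open>\<open>D2\<close> concerns parameter 0 only; moving the base point to
        \<open>z + t *\<^sub>R b\<close> gives the derivative at parameter \<open>t\<close>.\<close>
      from has_derivative_D2[OF this, of b a]
      have "((\<lambda>t. F' (z + t *\<^sub>R b) a) has_vector_derivative 0) (at t)"
        unfolding D2_zero[OF \<open>z + t *\<^sub>R b \<in> U\<close>] has_vector_derivative_iff_quotient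
        by (simp add: algebra_simps)
      then show ?thesis by (rule has_vector_derivative_at_within)
    qed
    then obtain k where "\<And>t. t \<in> {0..1} \<Longrightarrow> F' (z + t *\<^sub>R b) a = k"
      by (rule has_vector_derivative_zero_constant[of "{0..1::real}" "\<lambda>t. F' (z + t *\<^sub>R b) a", rotated]) auto
    from this[of 0] this[of 1] show ?thesis by (simp add: b_def)
  qed
  then have "F' z = F' w" if "w \<in> ball z e" for w using that by (intro blinfun_eqI)
  then show "\<forall>\<^sub>F w in at z within U. F' z = F' w"
    using e(1) by (auto simp: eventually_at dist_commute intro!: exI[of _ e])
qed

end

theorem theorem5:
  fixes U :: "(complex ^ 'n ^ 'n) set"
    and F :: "complex ^ 'n ^ 'n \<Rightarrow> complex ^ 'n ^ 'n"
  assumes "open U" and "connected U" and "0 \<in> U"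
    and "C1_on U F"
    and "F 0 = 0"
    and "\<And>x y. x \<in> U \<Longrightarrow> y \<in> U \<Longrightarrow> mat_spectrum (F x - F y) \<inter> mat_spectrum (x - y) \<noteq> {}"
  shows "\<exists>u :: complex ^ 'n ^ 'n. invertible u \<and>
           ((\<forall>x\<in>U. F x = u ** x ** matrix_inv u) \<or>
            (\<forall>x\<in>U. F x = u ** transpose x ** matrix_inv u))"
proof -
  obtain F' where F': "\<And>x. x \<in> U \<Longrightarrow> (F has_derivative blinfun_apply (F' x)) (at x)" "continuous_on U F'"
    using \<open>C1_on U F\<close> unfolding C1_on_def by blast
  interpret eigenvalue_sharing_derivatives U F F'
  proof (rule eigenvalue_sharing_derivatives.intro)
    show "eigenvalue_sharing (blinfun_apply (F' x))" if "x \<in> U" for x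
      using eigenvalue_sharing_derivative[OF assms(1) that F'(1)[OF that]] assms(6) that by blast
  qed (use assms(1) F' in auto)
  have "F x = F' 0 x" if "x \<in> U" for x
  proof -
    \<comment> \<open>Since \<open>F'\<close> is constant on \<open>U\<close>, the difference of
      \<open>F\<close> and \<open>F' 0\<close> has zero derivative there.\<close>
    have "F x - F' 0 x = F 0 - F' 0 0"
    proof (rule has_derivative_zero_unique_connected[OF assms(1,2) _ that assms(3)])
      fix y assume y: "y \<in> U"
      show "((\<lambda>x. F x - F' 0 x) has_derivative (\<lambda>x. 0)) (at y)"
        using has_derivative_diff[OF F'(1)[OF y]
            bounded_linear_imp_has_derivative[OF blinfun.bounded_linear_right[of "F' 0"]]]
        by (simp add: derivative_constant[OF assms(2) y assms(3)])
    qed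
    then show ?thesis by (simp add: \<open>F 0 = 0\<close>)
  qed
  then show ?thesis
    using eigenvalue_sharing.T_inner_or_transpose[OF sharing[OF assms(3)]] by metis
qed

end
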